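(* Let $N \geq 3$ and let $2 \leq a_1 < a_2 < \dots < a_N$ be relatively prime integers. Write $\mathbf{a} = (a_1,\dots,a_N)$, let $\|\mathbf{a}\|$ denote its Euclidean norm, and let $\mathcal{F} = \mathcal{F}(\mathbf{a})$ be the Frobenius number of this $N$-tuple. Then $$\mathcal{F} \leq \left[ \frac{(N-1) R_{\mathbf{a}}}{\|\mathbf{a}\|} \sum_{i=1}^N a_i \sqrt{ \|\mathbf{a}\|^2 - a_i^2} + 1 \right],$$ where $R_{\mathbf{a}}$ is the covering radius of the lattice $\Lambda_{\mathbf{a}}$ defined below and $[\,\cdot\,]$ denotes the integer part.
   Context: For relatively prime positive integers $a_1,\dots,a_N$, the Frobenius number $\mathcal{F}(a_1,\dots,a_N)$ is the largest positive integer that cannot be written as $\sum_{i=1}^N a_i x_i$ with $x_1,\dots,x_N$ non-negative integers. Let $\Lambda_{\mathbf{a}} = \{ \mathbf{x} \in \mathbb{Z}^N : \sum_{i=1}^N a_i x_i = 0\}$ and $V_{\mathbf{a}} = \operatorname{span}_{\mathbb{R}} \Lambda_{\mathbf{a}}$, an $(N-1)$-dimensional subspace of $\mathbb{R}^N$ in which $\Lambda_{\mathbf{a}}$ is a full-rank lattice. For $R>0$ let $B(R)$ be the closed $(N-1)$-dimensional Euclidean ball of radius $R$ centered at the origin in $V_{\mathbf{a}}$. The covering radius is $R_{\mathbf{a}} = \inf\{ R > 0 : B(R) + \Lambda_{\mathbf{a}} = V_{\mathbf{a}}\}$. $[x]$ denotes the integer part of $x$. *)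

theory Defs
  imports "HOL-Analysis.Analysis"
begin

text \<open>Tuples are indexed by a finite type with a linear order, so that \<open>N = CARD('n)\<close>
  and increasing tuples can be expressed.\<close>

definition representable :: "nat ^ 'n \<Rightarrow> nat \<Rightarrow> bool" where
  "representable a m \<longleftrightarrow> (\<exists>x :: nat ^ 'n. m = (\<Sum>i\<in>UNIV. a $ i * x $ i))"

text \<open>Meaningful only if the set of positive non-representable numbers is finite and nonempty,
  which holds when the entries are relatively prime and all at least 2.\<close>

definition frobenius_number :: "nat ^ 'n \<Rightarrow> nat" where
  "frobenius_number a = Max {m. 0 < m \<and> \<not> representable a m}"

definition real_vec :: "nat ^ 'n \<Rightarrow> real ^ 'n" where
  "real_vec a = (\<chi> i. real (a $ i))"

definition orth_lattice :: "nat ^ 'n \<Rightarrow> (real ^ 'n) set" where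
  "orth_lattice a = {x. (\<forall>i. x $ i \<in> \<int>) \<and> (\<Sum>i\<in>UNIV. real (a $ i) * x $ i) = 0}"

definition orth_space :: "nat ^ 'n \<Rightarrow> (real ^ 'n) set" where
  "orth_space a = span (orth_lattice a)"

definition orth_ball :: "nat ^ 'n \<Rightarrow> real \<Rightarrow> (real ^ 'n) set" where
  "orth_ball a R = cball 0 R \<inter> orth_space a"

definition covering_radius :: "nat ^ 'n \<Rightarrow> real" where
  "covering_radius a =
     Inf {R. 0 < R \<and> {b + l |b l. b \<in> orth_ball a R \<and> l \<in> orth_lattice a} = orth_space a}"

end

theory Submission
  imports Defs
begin

text \<open>A positive integer \<open>m\<close> is representable as soon as the simplex of nonnegative \<open>x\<close> with
  \<open>a \<bullet> x = m\<close> meets \<open>\<int>\<^sup>N\<close>. That simplex contains an \<open>(N-1)\<close>-dimensional ball whose radius is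
  \<open>m\<close> times a constant depending on \<open>a\<close> only. The integer points of the hyperplane form a
  translate of the lattice, so once the inradius exceeds the covering radius the ball contains one
  of them. This gives the bound even without the factor \<open>N - 1\<close>.\<close>

section \<open>A projection estimate and the Bezout identity\<close>

text \<open>Only the component of \<open>e\<close> orthogonal to \<open>u\<close> contributes to
  \<open>e \<bullet> y\<close>, so Cauchy-Schwarz applies to that component. With \<open>e\<close> a
  coordinate vector, this bounds how much a move inside the hyperplane can change one
  coordinate.\<close>

lemma abs_inner_le_orthogonal:
  fixes u e y :: "'a::real_inner"
  assumes e: "norm e = 1" and uy: "u \<bullet> y = 0"
  shows "\<bar>e \<bullet> y\<bar> * norm u \<le> norm y * sqrt ((norm u)\<^sup>2 - (u \<bullet> e)\<^sup>2)"
proof (cases "u = 0")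
  case False
  \<comment> \<open>\<open>(norm u)\<^sup>2\<close> times the orthogonal projection of \<open>e\<close> along \<open>u\<close>\<close>
  define w where "w = (u \<bullet> u) *\<^sub>R e - (u \<bullet> e) *\<^sub>R u"
  have ee: "e \<bullet> e = 1"
    using e by (simp add: norm_eq_1)
  have wy: "w \<bullet> y = (norm u)\<^sup>2 * (e \<bullet> y)"
    using uy by (simp add: w_def inner_diff_left power2_norm_eq_inner)
  have "(norm w)\<^sup>2 = (norm u)\<^sup>2 * ((norm u)\<^sup>2 - (u \<bullet> e)\<^sup>2)"
    unfolding power2_norm_eq_inner
    by (simp add: w_def inner_diff_left inner_diff_right inner_commute ee power2_eq_square
        algebra_simps)
  then have nw: "norm w = norm u * sqrt ((norm u)\<^sup>2 - (u \<bullet> e)\<^sup>2)"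
    by (metis norm_ge_zero real_sqrt_mult real_sqrt_unique)
  have "norm u * (\<bar>e \<bullet> y\<bar> * norm u) = \<bar>w \<bullet> y\<bar>"
    by (simp add: wy abs_mult power2_eq_square)
  also have "\<dots> \<le> norm w * norm y"
    by (rule Cauchy_Schwarz_ineq2)
  also have "\<dots> = norm u * (norm y * sqrt ((norm u)\<^sup>2 - (u \<bullet> e)\<^sup>2))"
    by (simp add: nw)
  finally show ?thesis
    using False by simp
qed simp

text \<open>Bezout for two numbers, iterated: each step rescales the old coefficients by
  \<open>v\<close>. It will supply an integer point on the hyperplane.\<close>

lemma bezout_sum:
  fixes f :: "'i \<Rightarrow> nat"
  assumes "finite A"
  shows "\<exists>z :: 'i \<Rightarrow> int. (\<Sum>i\<in>A. int (f i) * z i) = int (Gcd (f ` A))"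
  using assms
proof (induction A)
  case (insert x A)
  then obtain z where z: "(\<Sum>i\<in>A. int (f i) * z i) = int (Gcd (f ` A))"
    by blast
  obtain u v where uv: "u * int (f x) + v * int (Gcd (f ` A)) = gcd (int (f x)) (int (Gcd (f ` A)))"
    using bezout_int by blast
  define z' where "z' i = (if i = x then u else v * z i)" for i
  have "(\<Sum>i\<in>A. int (f i) * z' i) = v * (\<Sum>i\<in>A. int (f i) * z i)"
    using insert.hyps by (auto simp: z'_def sum_distrib_left intro!: sum.cong)
  then have "(\<Sum>i\<in>insert x A. int (f i) * z' i) = int (Gcd (f ` insert x A))"
    using insert.hyps z uv by (simp add: z'_def mult.commute)
  then show ?case by blast
qed simp

section \<open>The lattice and its real span\<close>

lemma inner_real_vec: "real_vec a \<bullet> x = (\<Sum>i\<in>UNIV. real (a $ i) * x $ i)"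
  by (simp add: inner_vec_def real_vec_def)

lemma orth_lattice_iff: "x \<in> orth_lattice a \<longleftrightarrow> (\<forall>i. x $ i \<in> \<int>) \<and> real_vec a \<bullet> x = 0"
  by (simp add: orth_lattice_def inner_real_vec)

lemma orth_lattice_0: "0 \<in> orth_lattice a"
  by (simp add: orth_lattice_iff)

lemma orth_lattice_add:
  "x \<in> orth_lattice a \<Longrightarrow> y \<in> orth_lattice a \<Longrightarrow> x + y \<in> orth_lattice a"
  by (auto simp: orth_lattice_iff inner_add_right)

lemma orth_lattice_scale:
  "x \<in> orth_lattice a \<Longrightarrow> of_int k *\<^sub>R x \<in> orth_lattice a"
  by (auto simp: orth_lattice_iff)

lemma orth_lattice_sum:
  "(\<And>i. i \<in> I \<Longrightarrow> f i \<in> orth_lattice a) \<Longrightarrow> sum f I \<in> orth_lattice a"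
  by (induction I rule: infinite_finite_induct) (auto intro: orth_lattice_0 orth_lattice_add)

text \<open>Turns membership in a span into one linear equation. The lattice vectors
  \<open>g i\<close>, weighted by \<open>x $ i / a $ k\<close>, sum to \<open>x\<close> minus a
  multiple of \<open>axis k 1\<close> whose coefficient is proportional to
  \<open>real_vec a \<bullet> x\<close>, hence zero.\<close>

lemma in_orth_space:
  fixes a :: "nat ^ 'n" and x :: "real ^ 'n"
  assumes k: "a $ k \<noteq> 0" and x: "real_vec a \<bullet> x = 0"
  shows "x \<in> orth_space a"
proof -
  define g where "g i = real (a $ k) *\<^sub>R axis i 1 - real (a $ i) *\<^sub>R (axis k 1 :: real ^ 'n)" for i
  have "g i \<in> orth_lattice a" for i
  proof -
    have "real_vec a \<bullet> g i = 0"
      by (simp add: g_def inner_diff_right inner_axis real_vec_def)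
    moreover have "g i $ j \<in> \<int>" for j
      by (simp add: g_def axis_def)
    ultimately show ?thesis
      by (simp add: orth_lattice_iff)
  qed
  then have mem: "(\<Sum>i\<in>UNIV. (x $ i / real (a $ k)) *\<^sub>R g i) \<in> orth_space a"
    unfolding orth_space_def by (intro span_sum span_scale span_base)
  have "(\<Sum>i\<in>UNIV. (x $ i / real (a $ k)) *\<^sub>R g i)
      = (\<Sum>i\<in>UNIV. x $ i *\<^sub>R axis i 1)
        - (\<Sum>i\<in>UNIV. real (a $ i) * x $ i / real (a $ k)) *\<^sub>R axis k 1"
    using k by (simp add: g_def scaleR_diff_right sum_subtractf scaleR_left.sum mult.commute)
  also have "(\<Sum>i\<in>UNIV. real (a $ i) * x $ i / real (a $ k)) = 0"
    using x by (simp add: inner_real_vec flip: sum_divide_distrib)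
  also have "(\<Sum>i\<in>UNIV. x $ i *\<^sub>R axis i 1) = x"
    using basis_expansion[of x] by (simp add: scalar_mult_eq_scaleR)
  finally show ?thesis
    using mem by simp
qed

section \<open>The covering radius\<close>

text \<open>Ensures that the \<open>Inf\<close> in \<open>covering_radius\<close> is a genuine
  infimum. Rounding down the coordinates with respect to independent lattice vectors spanning the
  space leaves a remainder of bounded norm.\<close>

lemma covering_radii_nonempty:
  fixes a :: "nat ^ 'n"
  shows "{R. 0 < R \<and> {b + l |b l. b \<in> orth_ball a R \<and> l \<in> orth_lattice a} = orth_space a} \<noteq> {}"
proof -
  obtain B where B: "B \<subseteq> orth_lattice a" "independent B" "orth_lattice a \<subseteq> span B"
    using maximal_independent_subset by blast
  have fin: "finite B"
    using B(2) independent_imp_finite by blast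
  \<comment> \<open>The summand 1 keeps \<open>R\<close> positive even if \<open>B\<close> is
    empty.\<close>
  define R where "R = 1 + (\<Sum>b\<in>B. norm b)"
  have pos: "R > 0"
    unfolding R_def by (intro add_pos_nonneg sum_nonneg) auto
  have "v \<in> {b + l |b l. b \<in> orth_ball a R \<and> l \<in> orth_lattice a}" if "v \<in> orth_space a" for v
  proof -
    have "v \<in> span B"
      using that B(3) unfolding orth_space_def by (metis span_mono span_span subsetD)
    then obtain c where v: "v = (\<Sum>b\<in>B. c b *\<^sub>R b)"
      using fin by (auto simp: span_finite)
    define l where "l = (\<Sum>b\<in>B. of_int \<lfloor>c b\<rfloor> *\<^sub>R b)"
    have l: "l \<in> orth_lattice a"
      unfolding l_def using B(1) by (intro orth_lattice_sum orth_lattice_scale) auto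
    have "v - l = (\<Sum>b\<in>B. frac (c b) *\<^sub>R b)"
      by (simp add: v l_def frac_def scaleR_diff_left sum_subtractf)
    also have "norm \<dots> \<le> (\<Sum>b\<in>B. norm b)"
    proof (rule sum_norm_le)
      fix b
      show "norm (frac (c b) *\<^sub>R b) \<le> norm b"
        using mult_right_mono[of "frac (c b)" 1 "norm b"] frac_lt_1[of "c b"] by simp
    qed
    finally have "norm (v - l) \<le> R"
      by (simp add: R_def)
    moreover have "v - l \<in> orth_space a"
      using that span_base[OF l] unfolding orth_space_def by (intro span_diff)
    ultimately have "v - l \<in> orth_ball a R"
      by (simp add: orth_ball_def)
    then show ?thesis
      using l by (intro CollectI exI[of _ "v - l"] exI[of _ l]) simp
  qed
  moreover have "b + l \<in> orth_space a" if "b \<in> orth_ball a R" "l \<in> orth_lattice a" for b l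
    using that unfolding orth_ball_def orth_space_def by (auto intro: span_add span_base)
  ultimately have "{b + l |b l. b \<in> orth_ball a R \<and> l \<in> orth_lattice a} = orth_space a"
    by blast
  then show ?thesis
    using pos by blast
qed

lemma covering_radius_nonneg: "covering_radius a \<ge> 0"
  unfolding covering_radius_def
  by (rule cInf_greatest[OF covering_radii_nonempty]) auto

text \<open>The strict inequality leaves room for a covering radius \<open>R < r\<close> from the
  set, so attainment of the infimum is not at issue.\<close>

lemma covering_radius_approx:
  assumes "v \<in> orth_space a" "r > covering_radius a"
  obtains l where "l \<in> orth_lattice a" "norm (v - l) \<le> r"
proof -
  from cInf_lessD[OF covering_radii_nonempty assms(2)[unfolded covering_radius_def]]
  obtain R where R: "{b + l |b l. b \<in> orth_ball a R \<and> l \<in> orth_lattice a} = orth_space a" "R < r"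
    by blast
  then obtain b l where "v = b + l" "b \<in> orth_ball a R" "l \<in> orth_lattice a"
    using assms(1) by blast
  then show ?thesis
    using R(2) by (intro that[of l]) (auto simp: orth_ball_def)
qed

section \<open>Integer points in the simplex and the Frobenius bound\<close>

lemma nonrepresentable_le:
  fixes a :: "nat ^ 'n"
  assumes card: "CARD('n) \<ge> 2" and pos: "\<And>i. a $ i > 0"
    and gcd: "Gcd (range (\<lambda>i. a $ i)) = 1" and m: "\<not> representable a m"
  shows "real m \<le> covering_radius a / norm (real_vec a) *
      (\<Sum>i\<in>UNIV. real (a $ i) * sqrt ((norm (real_vec a))\<^sup>2 - (real (a $ i))\<^sup>2))"
proof (rule ccontr)
  define u where "u = real_vec a"
  \<comment> \<open>\<open>s i / norm u\<close> is the sine of the angle between \<open>u\<close>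
    and the \<open>i\<close>-th axis. Within the hyperplane, a point with \<open>i\<close>-th
    coordinate t >= 0 lies at distance \<open>t * norm u / s i\<close> from the facet where that
    coordinate vanishes. Equating these distances to \<open>r\<close> gives the incentre
    \<open>c\<close> below, and \<open>u \<bullet> c = m\<close> then determines
    \<open>r\<close>.\<close>
  define s where "s i = sqrt ((norm u)\<^sup>2 - (real (a $ i))\<^sup>2)" for i
  define S where "S = (\<Sum>i\<in>UNIV. real (a $ i) * s i)"
  assume "\<not> ?thesis"
  then have big: "covering_radius a / norm u * S < real m"
    by (simp add: u_def s_def S_def)
  have u0: "u \<noteq> 0"
    using pos by (auto simp: u_def real_vec_def vec_eq_iff)
  have spos: "s i > 0" for i
  proof -
    have "UNIV \<noteq> {i}"
      using card by (metis card_1_singleton_iff One_nat_def Suc_1 Suc_n_not_le_n)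
    then obtain j where "j \<noteq> i"
      by blast
    then have "(real (a $ i))\<^sup>2 + (real (a $ j))\<^sup>2 = (\<Sum>k\<in>{i, j}. (real (a $ k))\<^sup>2)"
      by simp
    also have "\<dots> \<le> (\<Sum>k\<in>UNIV. (real (a $ k))\<^sup>2)"
      by (rule sum_mono2) auto
    also have "\<dots> = (norm u)\<^sup>2"
      unfolding power2_norm_eq_inner by (simp add: u_def inner_vec_def real_vec_def power2_eq_square)
    moreover have "(real (a $ j))\<^sup>2 > 0"
      using pos[of j] by simp
    ultimately show ?thesis
      unfolding s_def by (smt (verit) real_sqrt_gt_zero)
  qed
  have Spos: "S > 0"
    unfolding S_def using pos spos by (intro sum_pos) auto
  \<comment> \<open>inradius and incentre of the simplex\<close>
  define r where "r = real m * norm u / S"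
  define c :: "real ^ 'n" where "c = (\<chi> i. r * s i / norm u)"
  have "covering_radius a < r"
    using big Spos u0 by (simp add: r_def field_simps)
  have "u \<bullet> c = r / norm u * S"
    by (simp add: u_def inner_real_vec c_def S_def sum_distrib_left field_simps)
  then have uc: "u \<bullet> c = real m"
    using Spos u0 by (simp add: r_def)
  obtain z0 :: "'n \<Rightarrow> int" where z0: "(\<Sum>i\<in>UNIV. int (a $ i) * z0 i) = 1"
    using bezout_sum[of UNIV "\<lambda>i. a $ i"] gcd by auto
  \<comment> \<open>Bezout coefficients scaled by \<open>m\<close>: an integer point on the
    hyperplane, possibly with negative coordinates. Subtracting a suitable lattice vector brings it
    within \<open>r\<close> of \<open>c\<close>.\<close>
  define z :: "real ^ 'n" where "z = (\<chi> i. of_int (int m * z0 i))"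
  have "u \<bullet> z = real m * of_int (\<Sum>i\<in>UNIV. int (a $ i) * z0 i)"
    by (simp add: u_def inner_real_vec z_def sum_distrib_left mult.left_commute)
  then have uz: "u \<bullet> z = real m"
    by (simp add: z0)
  have "z - c \<in> orth_space a"
    using pos uz uc by (intro in_orth_space) (auto simp: u_def inner_diff_right)
  then obtain l where l: "l \<in> orth_lattice a" and dist: "norm (z - c - l) \<le> r"
    using \<open>covering_radius a < r\<close> covering_radius_approx by blast
  have ul: "u \<bullet> l = 0"
    using l by (simp add: orth_lattice_iff u_def)
  define y where "y = z - c - l"
  \<comment> \<open>Since \<open>z - l = c + y\<close>, it suffices that \<open>y\<close> changes
    the \<open>i\<close>-th coordinate by at most \<open>c $ i = r * s i / norm u\<close>.\<close>
  have "(z - l) $ i \<ge> 0" for i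
  proof -
    have "\<bar>axis i 1 \<bullet> y\<bar> * norm u \<le> norm y * sqrt ((norm u)\<^sup>2 - (u \<bullet> axis i 1)\<^sup>2)"
      using uz uc ul by (intro abs_inner_le_orthogonal) (auto simp: y_def inner_diff_right)
    also have "\<dots> = norm y * s i"
      by (simp add: s_def inner_axis u_def real_vec_def)
    also have "\<dots> \<le> r * s i"
      using dist spos[of i] by (simp add: y_def)
    finally have "\<bar>y $ i\<bar> \<le> c $ i"
      using u0 by (simp add: c_def inner_axis' field_simps)
    then show ?thesis
      by (simp add: y_def)
  qed
  moreover have "(z - l) $ i \<in> \<int>" for i
    using l by (auto simp: z_def orth_lattice_iff)
  ultimately have x: "real (nat \<lfloor>(z - l) $ i\<rfloor>) = (z - l) $ i" for i
    by (metis Ints_cases floor_of_int of_int_0_le_iff of_nat_nat)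
  have "real (\<Sum>i\<in>UNIV. a $ i * (\<chi> i. nat \<lfloor>(z - l) $ i\<rfloor>) $ i) = u \<bullet> (z - l)"
    unfolding u_def inner_real_vec of_nat_sum by (intro sum.cong) (simp_all only: vec_lambda_beta of_nat_mult x)
  also have "\<dots> = real m"
    using uz ul by (simp add: inner_diff_right)
  finally have "m = (\<Sum>i\<in>UNIV. a $ i * (\<chi> i. nat \<lfloor>(z - l) $ i\<rfloor>) $ i)"
    by linarith
  then show False
    using m unfolding representable_def by blast
qed

text \<open>Supplies an element of the set whose maximum is the Frobenius number.\<close>

lemma one_not_representable:
  fixes a :: "nat ^ 'n"
  assumes "\<And>i. a $ i \<ge> 2"
  shows "\<not> representable a 1"
proof
  assume "representable a 1"
  then obtain x :: "nat ^ 'n" where x: "(\<Sum>i\<in>UNIV. a $ i * x $ i) = 1"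
    unfolding representable_def by metis
  then obtain i where "a $ i * x $ i = 1"
    by (auto simp: sum_eq_Suc0_iff)
  then show False
    using assms[of i] by simp
qed

theorem theorem1p1:
  fixes a :: "nat ^ 'n::{finite,linorder}"
  assumes "CARD('n) \<ge> 3"
    and "\<And>i. a $ i \<ge> 2"
    and "strict_mono (\<lambda>i. a $ i)"
    and "Gcd (range (\<lambda>i. a $ i)) = 1"
  shows "int (frobenius_number a) \<le>
    \<lfloor>((real CARD('n) - 1) * covering_radius a) / norm (real_vec a) *
      (\<Sum>i\<in>UNIV. real (a $ i) * sqrt ((norm (real_vec a))\<^sup>2 - (real (a $ i))\<^sup>2)) + 1\<rfloor>"
proof -
  define b where "b = covering_radius a / norm (real_vec a) *
      (\<Sum>i\<in>UNIV. real (a $ i) * sqrt ((norm (real_vec a))\<^sup>2 - (real (a $ i))\<^sup>2))"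
  define M where "M = {m. 0 < m \<and> \<not> representable a m}"
  have "a $ i > 0" for i
    using assms(2)[of i] by linarith
  then have le: "real m \<le> b" if "m \<in> M" for m
    using nonrepresentable_le[of a m] that assms(1,4) by (auto simp: b_def M_def)
  \<comment> \<open>The uniform bound makes \<open>M\<close> finite, so that its \<open>Max\<close>
    belongs to it.\<close>
  have "M \<subseteq> {..nat \<lfloor>b\<rfloor>}"
    using le by (auto simp: le_nat_floor)
  then have "finite M"
    by (rule finite_subset) simp
  moreover have "1 \<in> M"
    using one_not_representable[OF assms(2)] by (simp add: M_def)
  ultimately have "frobenius_number a \<in> M"
    unfolding frobenius_number_def M_def[symmetric] by (intro Max_in) auto
  then have F: "real (frobenius_number a) \<le> b"
    by (rule le)
  \<comment> \<open>As an upper bound of a natural number, \<open>b\<close> is nonnegative, so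
    multiplying it by N - 1 >= 1 cannot decrease it.\<close>
  then have "0 \<le> b"
    using of_nat_0_le_iff order_trans by blast
  then have "1 * b \<le> (real CARD('n) - 1) * b"
    using assms(1) by (intro mult_right_mono) auto
  then have "real (frobenius_number a) \<le> (real CARD('n) - 1) * b + 1"
    using F by linarith
  then show ?thesis
    unfolding le_floor_iff b_def by (simp add: mult.assoc)
qed

end
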